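(* Let $\sigma_\hbar:\hbar\mathbb{Z}^n\times\mathbb{T}^n\to\mathbb{C}$ be a measurable function (with $\sigma_\hbar(k,\cdot)\in L^1(\mathbb{T}^n)$ for each $k$), let $\lambda\in\ell^1(\hbar\mathbb{Z}^n)$, and let $\omega$ be a positive function on $\hbar\mathbb{Z}^n$. Suppose that $|(\mathcal{F}_{\mathbb{T}^n}\sigma_\hbar)(k,m)|\le C|\lambda(m)|$ for all $k,m\in\hbar\mathbb{Z}^n$ with some constant $C>0$, and that $$|(\mathcal{F}_{\mathbb{T}^n}\sigma_\hbar)(k,m)|\le\omega(k)|\lambda(m)|\qquad\text{for all }m,k\in\hbar\mathbb{Z}^n,$$ where $$\lim_{|k|\to\infty}\omega(k)=0.$$ Then $\mathrm{Op}_{\hbar\mathbb{Z}^n}(\sigma_\hbar):\ell^p(\hbar\mathbb{Z}^n)\to\ell^p(\hbar\mathbb{Z}^n)$ is a compact operator for all $1\le p<\infty$.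
   Context: Fix $n\ge1$ and $\hbar\in(0,1]$. $\hbar\mathbb{Z}^n=\{\hbar\bar k:\bar k\in\mathbb{Z}^n\}\subset\mathbb{R}^n$ with counting measure, $|k|$ is the Euclidean norm, $\mathbb{T}^n=\mathbb{R}^n/\mathbb{Z}^n$ with normalized Haar measure, $k\cdot\theta=\sum_jk_j\theta_j$. Semi-classical Fourier transform: $\widehat f(\theta)=\sum_{k\in\hbar\mathbb{Z}^n}e^{-2\pi\frac{i}{\hbar}k\cdot\theta}f(k)$. Quantization: $\mathrm{Op}_{\hbar\mathbb{Z}^n}(\sigma_\hbar)f(k)=\int_{\mathbb{T}^n}e^{2\pi\frac{i}{\hbar}k\cdot\theta}\sigma_\hbar(k,\theta)\widehat f(\theta)\,d\theta$ for $f\in\ell^1(\hbar\mathbb{Z}^n)$, extended to $\ell^p$ by density. The Fourier transform in the second variable is $(\mathcal{F}_{\mathbb{T}^n}\sigma_\hbar)(k,m)=\int_{\mathbb{T}^n}e^{-2\pi\frac{i}{\hbar}m\cdot\theta}\sigma_\hbar(k,\theta)\,d\theta$, $m\in\hbar\mathbb{Z}^n$. *)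

theory Defs
  imports "HOL-Analysis.Analysis"
begin

definition hlattice :: "real \<Rightarrow> (real ^ 'n) set" where
  "hlattice h = {h *\<^sub>R k | k. \<forall>i. k $ i \<in> \<int>}"

text \<open>
  Functions on the torus are represented by functions on \<open>real ^ 'n\<close> that are invariant under
  integer translations. Integration against normalized Haar measure is Lebesgue integration over
  the unit cube.
\<close>

definition torus_periodic :: "(real ^ 'n \<Rightarrow> complex) \<Rightarrow> bool" where
  "torus_periodic g \<longleftrightarrow> (\<forall>\<theta> z. (\<forall>i. z $ i \<in> \<int>) \<longrightarrow> g (\<theta> + z) = g \<theta>)"

definition torus_measure :: "(real ^ 'n) measure" where
  "torus_measure = lebesgue_on (cbox 0 1)"

text \<open>
  A function on the lattice is represented by its extension by zero to \<open>real ^ 'n\<close>, so that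
  equality in the sequence spaces is equality of functions.
\<close>

definition lp :: "real \<Rightarrow> real \<Rightarrow> (real ^ 'n \<Rightarrow> complex) set" where
  "lp h p = {f. (\<forall>x. x \<notin> hlattice h \<longrightarrow> f x = 0) \<and>
                (\<lambda>k. norm (f k) powr p) summable_on hlattice h}"

definition lp_norm :: "real \<Rightarrow> real \<Rightarrow> (real ^ 'n \<Rightarrow> complex) \<Rightarrow> real" where
  "lp_norm h p f = (\<Sum>\<^sub>\<infinity>k\<in>hlattice h. norm (f k) powr p) powr (1 / p)"

definition lp_topology :: "real \<Rightarrow> real \<Rightarrow> (real ^ 'n \<Rightarrow> complex) topology" where
  "lp_topology h p = Metric_space.mtopology (lp h p) (\<lambda>f g. lp_norm h p (\<lambda>k. f k - g k))"

definition lp_bounded_linear ::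
    "real \<Rightarrow> real \<Rightarrow> ((real ^ 'n \<Rightarrow> complex) \<Rightarrow> (real ^ 'n \<Rightarrow> complex)) \<Rightarrow> bool" where
  "lp_bounded_linear h p T \<longleftrightarrow>
     (\<forall>f\<in>lp h p. T f \<in> lp h p) \<and>
     (\<forall>f\<in>lp h p. \<forall>g\<in>lp h p. T (\<lambda>k. f k + g k) = (\<lambda>k. T f k + T g k)) \<and>
     (\<forall>c. \<forall>f\<in>lp h p. T (\<lambda>k. c * f k) = (\<lambda>k. c * T f k)) \<and>
     (\<exists>B. \<forall>f\<in>lp h p. lp_norm h p (T f) \<le> B * lp_norm h p f)"

definition lp_compact_operator ::
    "real \<Rightarrow> real \<Rightarrow> ((real ^ 'n \<Rightarrow> complex) \<Rightarrow> (real ^ 'n \<Rightarrow> complex)) \<Rightarrow> bool" where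
  "lp_compact_operator h p T \<longleftrightarrow>
     lp_bounded_linear h p T \<and>
     compactin (lp_topology h p)
       (lp_topology h p closure_of (T ` {f \<in> lp h p. lp_norm h p f \<le> 1}))"

definition semiclassical_fourier ::
    "real \<Rightarrow> (real ^ 'n \<Rightarrow> complex) \<Rightarrow> real ^ 'n \<Rightarrow> complex" where
  "semiclassical_fourier h f \<theta> =
     (\<Sum>\<^sub>\<infinity>k\<in>hlattice h. exp (- 2 * of_real pi * (\<i> / of_real h) * of_real (k \<bullet> \<theta>)) * f k)"

definition torus_fourier ::
    "real \<Rightarrow> (real ^ 'n \<Rightarrow> real ^ 'n \<Rightarrow> complex) \<Rightarrow> real ^ 'n \<Rightarrow> real ^ 'n \<Rightarrow> complex" where
  "torus_fourier h \<sigma> k m =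
     (\<integral>\<theta>. exp (- 2 * of_real pi * (\<i> / of_real h) * of_real (m \<bullet> \<theta>)) * \<sigma> k \<theta> \<partial>torus_measure)"

text \<open>
  The quantization of a symbol as given by the integral formula, which is only meaningful for
  \<open>f \<in> lp h 1\<close>.
\<close>

definition Op_hlattice ::
    "real \<Rightarrow> (real ^ 'n \<Rightarrow> real ^ 'n \<Rightarrow> complex) \<Rightarrow> (real ^ 'n \<Rightarrow> complex) \<Rightarrow> real ^ 'n \<Rightarrow> complex" where
  "Op_hlattice h \<sigma> f k =
     (if k \<in> hlattice h then
        (\<integral>\<theta>. exp (2 * of_real pi * (\<i> / of_real h) * of_real (k \<bullet> \<theta>)) * \<sigma> k \<theta>
              * semiclassical_fourier h f \<theta> \<partial>torus_measure)
      else 0)"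

text \<open>
  \<open>T\<close> is the extension of the quantization by density to \<open>lp h p\<close>. For \<open>1 \<le> p\<close> the space
  \<open>lp h 1\<close> is a dense subspace of \<open>lp h p\<close>, so there is at most one such operator on \<open>lp h p\<close>.
\<close>

definition is_Op_extension ::
    "real \<Rightarrow> (real ^ 'n \<Rightarrow> real ^ 'n \<Rightarrow> complex) \<Rightarrow> real \<Rightarrow>
     ((real ^ 'n \<Rightarrow> complex) \<Rightarrow> (real ^ 'n \<Rightarrow> complex)) \<Rightarrow> bool" where
  "is_Op_extension h \<sigma> p T \<longleftrightarrow>
     lp_bounded_linear h p T \<and> (\<forall>f\<in>lp h 1. T f = Op_hlattice h \<sigma> f)"

end

theory Submission
  imports Defs "HOL-Complex_Analysis.Great_Picard"
begin

text \<open>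
  Substituting \<open>l = k + m\<close> in the Fourier series of \<open>f\<close> and integrating termwise turns the
  quantization on \<open>lp h 1\<close> into \<open>f \<mapsto> (\<Sum>m. a k m * f (k + m))\<close> with
  \<open>a = torus_fourier h \<sigma>\<close>. By Young's inequality for the convolution with \<open>\<bar>lam\<bar>\<close> this kernel
  operator is bounded on every \<open>lp h p\<close>, hence it is the only extension by density. The bound
  \<open>norm (a k m) \<le> \<omega> k * norm (lam m)\<close> makes the \<open>p\<close>-sums over \<open>norm k > R\<close> of the image of the
  unit ball uniformly small, so a sequence in the image has a pointwise convergent subsequence, and
  it converges in norm.
\<close>

subsection \<open>Convexity of powers\<close>

text \<open>Convexity and differentiability of \<open>x powr p\<close> are available on the open
  half-line \<open>{0<..}\<close>. The endpoint \<open>x = 0\<close>, which is needed because norms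
  may vanish, is checked directly: there the tangent has value \<open>(1 - p) * t powr p\<close>,
  which is nonpositive.\<close>

lemma powr_above_tangent:
  fixes t x p :: real
  assumes t: "0 < t" and x: "0 \<le> x" and p: "1 \<le> p"
  shows "t powr p + p * t powr (p - 1) * (x - t) \<le> x powr p"
proof (cases "x = 0")
  case True
  have "t powr (p - 1) * t = t powr p"
    using t by (simp add: powr_diff)
  then have "t powr p + p * t powr (p - 1) * (x - t) = (1 - p) * t powr p"
    using True by (simp add: algebra_simps)
  also have "\<dots> \<le> 0"
    using p by (simp add: mult_nonpos_nonneg)
  finally show ?thesis using True p by simp
next
  case False
  have "p * t powr (p - 1) * (x - t) \<le> x powr p - t powr p"
  proof (rule convex_on_imp_above_tangent[where A = "{0<..}"])
    show "convex_on {0<..} (\<lambda>x. x powr p)"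
      using p by (rule powr_convex)
    show "((\<lambda>x. x powr p) has_field_derivative p * t powr (p - 1)) (at t within {0<..})"
      using t by (auto intro!: derivative_eq_intros)
  qed (use t x False in \<open>auto simp: interior_open\<close>)
  then show ?thesis by simp
qed

text \<open>Add the tangent inequalities at the weighted mean \<open>t = u * x + v * y\<close> with
  weights \<open>u\<close> and \<open>v\<close>; the linear terms cancel. A vanishing mean is
  separated because the tangent requires \<open>0 < t\<close>.\<close>

lemma powr_convex_combination:
  fixes x y u v p :: real
  assumes "0 \<le> x" "0 \<le> y" "0 \<le> u" "0 \<le> v" "u + v = 1" "1 \<le> p"
  shows "(u * x + v * y) powr p \<le> u * x powr p + v * y powr p"
proof (cases "u * x + v * y = 0")
  case True
  then show ?thesis using assms by simp
next
  case False
  define t where "t = u * x + v * y"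
  have t: "0 < t"
    using False assms by (simp add: t_def less_le)
  have "u * (t powr p + p * t powr (p - 1) * (x - t)) + v * (t powr p + p * t powr (p - 1) * (y - t))
      \<le> u * x powr p + v * y powr p"
    using assms t by (intro add_mono mult_left_mono powr_above_tangent) auto
  also have "u * (t powr p + p * t powr (p - 1) * (x - t)) + v * (t powr p + p * t powr (p - 1) * (y - t))
      = (u + v) * t powr p + p * t powr (p - 1) * (t - (u + v) * t)"
    by (simp add: t_def algebra_simps)
  finally show ?thesis
    using assms by (simp add: t_def)
qed

text \<open>Jensen's inequality with weights of arbitrary total mass \<open>W\<close>, obtained by
  summing the tangent inequality at the mean \<open>s / W\<close>. It plays the part of Hoelder's
  inequality in the convolution estimate.\<close>

lemma jensen_powr_infsum:
  fixes w x :: "'a \<Rightarrow> real"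
  assumes p: "1 \<le> p" and w0: "\<And>a. a \<in> A \<Longrightarrow> 0 \<le> w a" and x0: "\<And>a. a \<in> A \<Longrightarrow> 0 \<le> x a"
    and w: "w summable_on A" and wx: "(\<lambda>a. w a * x a) summable_on A"
    and wxp: "(\<lambda>a. w a * x a powr p) summable_on A"
  shows "(\<Sum>\<^sub>\<infinity>a\<in>A. w a * x a) powr p
      \<le> (\<Sum>\<^sub>\<infinity>a\<in>A. w a) powr (p - 1) * (\<Sum>\<^sub>\<infinity>a\<in>A. w a * x a powr p)"
proof -
  define W s where "W = (\<Sum>\<^sub>\<infinity>a\<in>A. w a)" and "s = (\<Sum>\<^sub>\<infinity>a\<in>A. w a * x a)"
  define R where "R = (\<Sum>\<^sub>\<infinity>a\<in>A. w a * x a powr p)"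
  have R: "0 \<le> R" and s: "0 \<le> s" and W: "0 \<le> W"
    unfolding R_def s_def W_def using w0 x0 by (auto intro!: infsum_nonneg)
  show ?thesis
  proof (cases "s = 0")
    case True
    then show ?thesis using R p by (simp add: s_def R_def)
  next
    case False
    \<comment> \<open>Zero total mass would force every weight, and hence \<open>s\<close>, to
      vanish; so the mean \<open>s / W\<close> is meaningful and positive.\<close>
    have "W \<noteq> 0"
    proof
      assume "W = 0"
      then have "w a = 0" if "a \<in> A" for a
        using nonneg_infsum_le_0D[of w A a] w w0 that by (auto simp: W_def)
      then have "s = 0" by (simp add: s_def cong: infsum_cong)
      with False show False ..
    qed
    with W have W: "0 < W" by simp
    define t where "t = s / W"
    have t: "0 < t" using False s W by (simp add: t_def)
    define c where "c = t powr p - p * t powr (p - 1) * t"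
    have hs: "((\<lambda>a. w a * c + (p * t powr (p - 1)) * (w a * x a)) has_sum
        (W * c + (p * t powr (p - 1)) * s)) A"
      unfolding W_def s_def using w wx
      by (intro has_sum_add has_sum_cmult_left has_sum_cmult_right has_sum_infsum)
    have "W * c + (p * t powr (p - 1)) * s \<le> R"
    proof (rule has_sum_mono[OF hs])
      show "((\<lambda>a. w a * x a powr p) has_sum R) A"
        unfolding R_def using wxp by (rule has_sum_infsum)
      fix a assume a: "a \<in> A"
      have "w a * (t powr p + p * t powr (p - 1) * (x a - t)) \<le> w a * x a powr p"
        using a p t w0 x0 by (intro mult_left_mono powr_above_tangent) auto
      then show "w a * c + (p * t powr (p - 1)) * (w a * x a) \<le> w a * x a powr p"
        by (simp add: c_def algebra_simps)
    qed
    \<comment> \<open>Because \<open>s = W * t\<close>, the first-order terms of the tangent cancel.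
      Multiplying by \<open>W powr (p - 1)\<close> then turns \<open>W * t powr p\<close> into
      \<open>s powr p\<close>.\<close>
    moreover have "W * c + (p * t powr (p - 1)) * s = W * t powr p"
      using W by (simp add: c_def t_def field_simps)
    ultimately have "W powr (p - 1) * (W * t powr p) \<le> W powr (p - 1) * R"
      by (intro mult_left_mono) auto
    also have "W powr (p - 1) * (W * t powr p) = (W * t) powr p"
      using W t by (simp add: powr_mult powr_diff)
    also have "W * t = s" using W by (simp add: t_def)
    finally show ?thesis by (simp add: W_def s_def R_def)
  qed
qed

subsection \<open>The sequence spaces\<close>

lemma lp_norm_nonneg: "0 \<le> lp_norm h p f"
  by (simp add: lp_norm_def)

lemma lp_norm_powr:
  assumes "0 < p"
  shows "lp_norm h p f powr p = (\<Sum>\<^sub>\<infinity>k\<in>hlattice h. norm (f k) powr p)"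
  using assms by (simp add: lp_norm_def powr_powr infsum_nonneg)

lemma lp_outside: "f \<in> lp h p \<Longrightarrow> k \<notin> hlattice h \<Longrightarrow> f k = 0"
  by (simp add: lp_def)

lemma lp_sum_le:
  assumes "f \<in> lp h p" "0 < p" "finite F" "F \<subseteq> hlattice h"
  shows "(\<Sum>k\<in>F. norm (f k) powr p) \<le> lp_norm h p f powr p"
  unfolding lp_norm_powr[OF assms(2)] using assms
  by (intro finite_sum_le_infsum) (auto simp: lp_def)

text \<open>Nonnegative terms are summable as soon as their finite partial sums are bounded. This
  reduces membership and norm estimates to finite sums, the form in which all later bounds are
  proved.\<close>

lemma lp_norm_le:
  assumes f: "\<And>k. k \<notin> hlattice h \<Longrightarrow> f k = 0" and "0 < p" "0 \<le> a"
    and bnd: "\<And>F. finite F \<Longrightarrow> F \<subseteq> hlattice h \<Longrightarrow> (\<Sum>k\<in>F. norm (f k) powr p) \<le> a powr p"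
  shows "f \<in> lp h p" and "lp_norm h p f \<le> a"
proof -
  have s: "(\<lambda>k. norm (f k) powr p) summable_on hlattice h"
    using bnd by (intro nonneg_bdd_above_summable_on) (auto intro!: bdd_aboveI2)
  then show "f \<in> lp h p" using f by (simp add: lp_def)
  have "(\<Sum>\<^sub>\<infinity>k\<in>hlattice h. norm (f k) powr p) \<le> a powr p"
    using s bnd by (rule infsum_le_finite_sums)
  then have "lp_norm h p f \<le> (a powr p) powr (1 / p)"
    unfolding lp_norm_def using \<open>0 < p\<close> by (intro powr_mono2) (auto intro: infsum_nonneg)
  also have "\<dots> = a" using assms by (simp add: powr_powr)
  finally show "lp_norm h p f \<le> a" .
qed

lemma lp_norm_pointwise:
  assumes "f \<in> lp h p" "0 < p"
  shows "norm (f k) \<le> lp_norm h p f"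
proof (cases "k \<in> hlattice h")
  case True
  then have "norm (f k) powr p \<le> lp_norm h p f powr p"
    using lp_sum_le[OF assms, of "{k}"] by simp
  then show ?thesis using assms by (meson lp_norm_nonneg not_le powr_less_mono2)
qed (use assms in \<open>simp add: lp_outside lp_norm_nonneg\<close>)

text \<open>Extension by zero off the lattice is what makes a vanishing norm determine the whole
  function, as the metric axioms demand.\<close>

lemma lp_norm_eq_0_iff:
  assumes "f \<in> lp h p" "0 < p"
  shows "lp_norm h p f = 0 \<longleftrightarrow> f = (\<lambda>_. 0)"
proof
  assume "lp_norm h p f = 0"
  then show "f = (\<lambda>_. 0)" using lp_norm_pointwise[OF assms] by (auto simp: fun_eq_iff)
qed (simp add: lp_norm_def)

lemma lp_norm_minus_commute: "lp_norm h p (\<lambda>k. f k - g k) = lp_norm h p (\<lambda>k. g k - f k)"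
  by (simp add: lp_norm_def norm_minus_commute)

lemma lp_cmult:
  assumes "f \<in> lp h p"
  shows "(\<lambda>k. c * f k) \<in> lp h p"
  using assms by (simp add: lp_def norm_mult powr_mult summable_on_cmult_right)

text \<open>Minkowski's inequality by convexity: \<open>f + g\<close> is \<open>a + b\<close> times
  a convex combination of \<open>f / a\<close> and \<open>g / b\<close>. Choosing \<open>a\<close>
  and \<open>b\<close> strictly above the two norms avoids division by zero; afterwards they
  decrease to the norms.\<close>

lemma
  assumes p: "1 \<le> p" and f: "f \<in> lp h p" and g: "g \<in> lp h p"
  shows lp_add: "(\<lambda>k. f k + g k) \<in> lp h p"
    and lp_norm_triangle: "lp_norm h p (\<lambda>k. f k + g k) \<le> lp_norm h p f + lp_norm h p g"
proof -
  have key: "(\<lambda>k. f k + g k) \<in> lp h p \<and> lp_norm h p (\<lambda>k. f k + g k) \<le> a + b"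
    if a: "lp_norm h p f < a" and b: "lp_norm h p g < b" for a b
  proof -
    have ab: "0 < a" "0 < b"
      using a b lp_norm_nonneg[of h p f] lp_norm_nonneg[of h p g] by linarith+
    \<comment> \<open>These weights satisfy \<open>u / a = v / b = 1 / (a + b)\<close>, so rescaling
      by \<open>a + b\<close> recovers the sum of the two norms.\<close>
    define u v where "u = a / (a + b)" and "v = b / (a + b)"
    have uv: "0 \<le> u" "0 \<le> v" "u + v = 1"
      using ab by (auto simp: u_def v_def simp flip: add_divide_distrib)
    have fin: "(\<Sum>k\<in>F. norm (f k + g k) powr p) \<le> (a + b) powr p"
      if F: "finite F" "F \<subseteq> hlattice h" for F
    proof -
      have "norm (f k + g k) powr p
          \<le> (a + b) powr p * (u * (norm (f k) powr p / a powr p) + v * (norm (g k) powr p / b powr p))" for k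
      proof -
        have "norm (f k + g k) \<le> norm (f k) + norm (g k)" by (rule norm_triangle_ineq)
        also have "\<dots> = (a + b) * (u * (norm (f k) / a) + v * (norm (g k) / b))"
          using ab by (simp add: u_def v_def distrib_left)
        finally have "norm (f k + g k) powr p \<le> \<dots> powr p"
          using p by (intro powr_mono2) auto
        also have "\<dots> = (a + b) powr p * (u * (norm (f k) / a) + v * (norm (g k) / b)) powr p"
          using ab uv by (intro powr_mult)
        also have "\<dots> \<le> (a + b) powr p * (u * (norm (f k) / a) powr p + v * (norm (g k) / b) powr p)"
          using ab uv p by (intro mult_left_mono powr_convex_combination) auto
        finally show ?thesis using ab by (simp add: powr_divide)
      qed
      then have "(\<Sum>k\<in>F. norm (f k + g k) powr p)
          \<le> (\<Sum>k\<in>F. (a + b) powr p * (u * (norm (f k) powr p / a powr p) + v * (norm (g k) powr p / b powr p)))"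
        by (rule sum_mono)
      also have "\<dots> = (a + b) powr p * (u * ((\<Sum>k\<in>F. norm (f k) powr p) / a powr p)
          + v * ((\<Sum>k\<in>F. norm (g k) powr p) / b powr p))"
        by (simp only: sum_distrib_left[symmetric] sum.distrib sum_divide_distrib[symmetric])
      also have "\<dots> \<le> (a + b) powr p * (u * 1 + v * 1)"
      proof (intro mult_left_mono add_mono)
        have "(\<Sum>k\<in>F. norm (f k) powr p) \<le> a powr p"
          using lp_sum_le[OF f _ F] a p powr_mono2[of p "lp_norm h p f" a] lp_norm_nonneg[of h p f] by simp
        then show "(\<Sum>k\<in>F. norm (f k) powr p) / a powr p \<le> 1" using ab by simp
        have "(\<Sum>k\<in>F. norm (g k) powr p) \<le> b powr p"
          using lp_sum_le[OF g _ F] b p powr_mono2[of p "lp_norm h p g" b] lp_norm_nonneg[of h p g] by simp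
        then show "(\<Sum>k\<in>F. norm (g k) powr p) / b powr p \<le> 1" using ab by simp
      qed (use uv in auto)
      finally show ?thesis using uv by simp
    qed
    show ?thesis
      using lp_norm_le[OF _ _ _ fin] p ab f g by (auto simp: lp_outside)
  qed
  show "(\<lambda>k. f k + g k) \<in> lp h p"
    using key[of "lp_norm h p f + 1" "lp_norm h p g + 1"] by simp
  show "lp_norm h p (\<lambda>k. f k + g k) \<le> lp_norm h p f + lp_norm h p g"
  proof (rule field_le_epsilon)
    fix e :: real assume "0 < e"
    then show "lp_norm h p (\<lambda>k. f k + g k) \<le> lp_norm h p f + lp_norm h p g + e"
      using key[of "lp_norm h p f + e / 2" "lp_norm h p g + e / 2"] by simp
  qed
qed

lemma lp_diff:
  assumes "1 \<le> p" "f \<in> lp h p" "g \<in> lp h p"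
  shows "(\<lambda>k. f k - g k) \<in> lp h p"
  using lp_add[OF assms(1,2) lp_cmult[OF assms(3), of "-1"]] by simp

lemma Metric_space_lp:
  assumes p: "1 \<le> p"
  shows "Metric_space (lp h p) (\<lambda>f g. lp_norm h p (\<lambda>k. f k - g k))"
proof
  fix f g l :: "real ^ 'n \<Rightarrow> complex"
  show "0 \<le> lp_norm h p (\<lambda>k. f k - g k)" by (rule lp_norm_nonneg)
  show "lp_norm h p (\<lambda>k. f k - g k) = lp_norm h p (\<lambda>k. g k - f k)"
    by (rule lp_norm_minus_commute)
  assume f: "f \<in> lp h p" and g: "g \<in> lp h p"
  show "lp_norm h p (\<lambda>k. f k - g k) = 0 \<longleftrightarrow> f = g"
    using lp_norm_eq_0_iff[OF lp_diff[OF p f g]] p by (auto simp: fun_eq_iff)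
  assume l: "l \<in> lp h p"
  show "lp_norm h p (\<lambda>k. f k - l k) \<le> lp_norm h p (\<lambda>k. f k - g k) + lp_norm h p (\<lambda>k. g k - l k)"
    using lp_norm_triangle[OF p lp_diff[OF p f g] lp_diff[OF p g l]] by simp
qed

subsection \<open>Relative compactness\<close>

text \<open>Take \<open>K\<close> with partial sum within \<open>e\<close> of the total. A finite
  set disjoint from \<open>K\<close> can only add what is left of the total, since all terms are
  nonnegative.\<close>

lemma lp_tail:
  assumes f: "f \<in> lp h p" and e: "0 < e"
  obtains K where "finite K" "K \<subseteq> hlattice h"
    "\<And>F. finite F \<Longrightarrow> F \<subseteq> hlattice h - K \<Longrightarrow> (\<Sum>k\<in>F. norm (f k) powr p) \<le> e"
proof -
  define s where "s = (\<Sum>\<^sub>\<infinity>k\<in>hlattice h. norm (f k) powr p)"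
  have sm: "(\<lambda>k. norm (f k) powr p) summable_on hlattice h"
    using f by (simp add: lp_def)
  then obtain K where K: "finite K" "K \<subseteq> hlattice h"
      and Ks: "dist (\<Sum>k\<in>K. norm (f k) powr p) s \<le> e"
    using has_sum_finite_approximation[OF has_sum_infsum[OF sm] e] unfolding s_def by blast
  have "(\<Sum>k\<in>F. norm (f k) powr p) \<le> e" if F: "finite F" "F \<subseteq> hlattice h - K" for F
  proof -
    have "(\<Sum>k\<in>K. norm (f k) powr p) + (\<Sum>k\<in>F. norm (f k) powr p) = (\<Sum>k\<in>K \<union> F. norm (f k) powr p)"
      using K F by (intro sum.union_disjoint[symmetric]) auto
    also have "\<dots> \<le> s"
      unfolding s_def using sm K F by (intro finite_sum_le_infsum) auto
    finally show ?thesis using Ks by (simp add: dist_real_def)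
  qed
  with K show thesis by (rule that)
qed

text \<open>From \<open>x + y \<le> 2 * max x y\<close>. The crude constant suffices, as it is
  applied only to tails that can be made arbitrarily small.\<close>

lemma powr_add_le:
  fixes x y p :: real
  assumes "0 \<le> x" "0 \<le> y" "0 \<le> p"
  shows "(x + y) powr p \<le> 2 powr p * (x powr p + y powr p)"
proof -
  have "(x + y) powr p \<le> (2 * max x y) powr p"
    using assms by (intro powr_mono2) auto
  also have "\<dots> = 2 powr p * max x y powr p"
    using assms by (simp add: powr_mult)
  also have "\<dots> \<le> 2 powr p * (x powr p + y powr p)"
    by (intro mult_left_mono) (auto simp: max_def)
  finally show ?thesis .
qed

text \<open>A Vitali-type criterion: uniformly small tails reduce norm convergence to finitely many
  coordinates, where pointwise convergence is enough.\<close>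

lemma lp_converges_if_tails:
  fixes g :: "nat \<Rightarrow> real ^ 'n \<Rightarrow> complex"
  assumes p: "1 \<le> p" and g: "\<And>n. g n \<in> lp h p" and bnd: "\<And>n. lp_norm h p (g n) \<le> B"
    and lim: "\<And>k. (\<lambda>n. g n k) \<longlonglongrightarrow> l k"
    and tails: "\<And>e. 0 < e \<Longrightarrow> \<exists>K. finite K \<and> K \<subseteq> hlattice h \<and>
      (\<forall>n F. finite F \<longrightarrow> F \<subseteq> hlattice h - K \<longrightarrow> (\<Sum>k\<in>F. norm (g n k) powr p) \<le> e)"
  shows "l \<in> lp h p" and "(\<lambda>n. lp_norm h p (\<lambda>k. g n k - l k)) \<longlonglongrightarrow> 0"
proof -
  have p0: "0 < p" using p by simp
  have B: "0 \<le> B" using bnd[of 0] lp_norm_nonneg[of h p "g 0"] by linarith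
  \<comment> \<open>Bounds on finite sums that are uniform in \<open>n\<close> pass to the pointwise
    limit. This serves twice: for the membership of \<open>l\<close> and for its tails. Limits
    \<open>norm (l k)\<close> may be zero, where continuity of the power uses
    \<open>0 < p\<close>.\<close>
  have lsum: "(\<Sum>k\<in>F. norm (l k) powr p) \<le> b"
    if "\<And>n. (\<Sum>k\<in>F. norm (g n k) powr p) \<le> b" for F b
  proof (rule tendsto_upperbound)
    show "(\<lambda>n. \<Sum>k\<in>F. norm (g n k) powr p) \<longlonglongrightarrow> (\<Sum>k\<in>F. norm (l k) powr p)"
      using p0 lim by (intro tendsto_sum tendsto_powr' tendsto_norm tendsto_const) auto
  qed (use that in auto)
  have l0: "l k = 0" if "k \<notin> hlattice h" for k
  proof -
    have "(\<lambda>n. g n k) = (\<lambda>n. 0)" using lp_outside[OF g that] by simp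
    then show ?thesis using lim[of k] by (simp add: LIMSEQ_const_iff)
  qed
  show "l \<in> lp h p"
  proof (rule lp_norm_le(1)[OF l0 p0 B])
    fix F :: "(real ^ 'n) set" assume F: "finite F" "F \<subseteq> hlattice h"
    show "(\<Sum>k\<in>F. norm (l k) powr p) \<le> B powr p"
    proof (rule lsum)
      fix n
      have "(\<Sum>k\<in>F. norm (g n k) powr p) \<le> lp_norm h p (g n) powr p"
        by (rule lp_sum_le[OF g p0 F])
      also have "\<dots> \<le> B powr p"
        using bnd p0 by (intro powr_mono2) (auto simp: lp_norm_nonneg)
      finally show "(\<Sum>k\<in>F. norm (g n k) powr p) \<le> B powr p" .
    qed
  qed
  show "(\<lambda>n. lp_norm h p (\<lambda>k. g n k - l k)) \<longlonglongrightarrow> 0"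
  proof (rule LIMSEQ_I)
    fix r :: real assume r: "0 < r"
    \<comment> \<open>The target is norm at most \<open>r / 2\<close>, which is strictly below
      \<open>r\<close>. The tolerance \<open>d\<close> solves
      \<open>2 powr p * (d + d) = e / 2\<close>, so tail and finite part each receive half of
      \<open>e\<close>.\<close>
    define e where "e = (r / 2) powr p"
    define d where "d = e / (4 * 2 powr p)"
    have e: "0 < e" and d: "0 < d" using r by (auto simp: e_def d_def)
    obtain K where K: "finite K" "K \<subseteq> hlattice h"
      and tail: "\<And>n F. finite F \<Longrightarrow> F \<subseteq> hlattice h - K \<Longrightarrow> (\<Sum>k\<in>F. norm (g n k) powr p) \<le> d"
      using tails[OF d] by blast
    have "(\<lambda>n. \<Sum>k\<in>K. norm (g n k - l k) powr p) \<longlonglongrightarrow> (\<Sum>k\<in>K. norm (l k - l k) powr p)"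
      using p0 lim by (intro tendsto_sum tendsto_powr' tendsto_norm tendsto_const tendsto_diff) auto
    then have "(\<lambda>n. \<Sum>k\<in>K. norm (g n k - l k) powr p) \<longlonglongrightarrow> 0" by simp
    then have "\<forall>\<^sub>F n in sequentially. (\<Sum>k\<in>K. norm (g n k - l k) powr p) < e / 2"
      using e by (intro order_tendstoD(2)) auto
    then obtain N where N: "\<And>n. N \<le> n \<Longrightarrow> (\<Sum>k\<in>K. norm (g n k - l k) powr p) < e / 2"
      by (auto simp: eventually_sequentially)
    have "norm (lp_norm h p (\<lambda>k. g n k - l k) - 0) < r" if n: "N \<le> n" for n
    proof -
      have "lp_norm h p (\<lambda>k. g n k - l k) \<le> r / 2"
      proof (rule lp_norm_le(2))
        fix F :: "(real ^ 'n) set" assume F: "finite F" "F \<subseteq> hlattice h"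
        \<comment> \<open>Inside \<open>K\<close> the choice of \<open>N\<close> applies; outside,
          the tails of \<open>g n\<close> and of \<open>l\<close> are estimated separately.\<close>
        have "(\<Sum>k\<in>F. norm (g n k - l k) powr p)
            = (\<Sum>k\<in>F \<inter> K. norm (g n k - l k) powr p) + (\<Sum>k\<in>F - K. norm (g n k - l k) powr p)"
          using F(1) by (rule sum.Int_Diff)
        also have "\<dots> \<le> e / 2 + e / 2"
        proof (rule add_mono)
          have "(\<Sum>k\<in>F \<inter> K. norm (g n k - l k) powr p) \<le> (\<Sum>k\<in>K. norm (g n k - l k) powr p)"
            using K by (intro sum_mono2) auto
          then show "(\<Sum>k\<in>F \<inter> K. norm (g n k - l k) powr p) \<le> e / 2"
            using N[OF n] by simp
          have FK: "finite (F - K)" "F - K \<subseteq> hlattice h - K" using F by auto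
          have "(\<Sum>k\<in>F - K. norm (g n k - l k) powr p)
              \<le> (\<Sum>k\<in>F - K. 2 powr p * (norm (g n k) powr p + norm (l k) powr p))"
          proof (rule sum_mono)
            fix k
            have "norm (g n k - l k) powr p \<le> (norm (g n k) + norm (l k)) powr p"
              using p0 by (intro powr_mono2 norm_triangle_ineq4) auto
            also have "\<dots> \<le> 2 powr p * (norm (g n k) powr p + norm (l k) powr p)"
              using p0 by (intro powr_add_le) auto
            finally show "norm (g n k - l k) powr p \<le> 2 powr p * (norm (g n k) powr p + norm (l k) powr p)" .
          qed
          also have "\<dots> = 2 powr p * ((\<Sum>k\<in>F - K. norm (g n k) powr p) + (\<Sum>k\<in>F - K. norm (l k) powr p))"
            by (simp only: sum_distrib_left[symmetric] sum.distrib)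
          also have "\<dots> \<le> 2 powr p * (d + d)"
            using tail[OF FK] lsum[OF tail[OF FK]] by (intro mult_left_mono add_mono) auto
          also have "\<dots> = e / 2" by (simp add: d_def)
          finally show "(\<Sum>k\<in>F - K. norm (g n k - l k) powr p) \<le> e / 2" .
        qed
        finally show "(\<Sum>k\<in>F. norm (g n k - l k) powr p) \<le> (r / 2) powr p" by (simp add: e_def)
      qed (use r p0 l0 lp_outside[OF g] in auto)
      then show ?thesis using r lp_norm_nonneg[of h p "\<lambda>k. g n k - l k"] by simp
    qed
    then show "\<exists>N. \<forall>n\<ge>N. norm (lp_norm h p (\<lambda>k. g n k - l k) - 0) < r" by blast
  qed
qed

section \<open>Countability, local finiteness and group structure of the lattice\<close>

lemma hlattice_eq:
  "hlattice h = range (\<lambda>z :: 'n \<Rightarrow> int. h *\<^sub>R (\<chi> i. real_of_int (z i)) :: real ^ 'n)"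
proof (intro equalityI subsetI)
  fix x :: "real ^ 'n" assume "x \<in> hlattice h"
  then obtain k where x: "x = h *\<^sub>R k" and k: "\<forall>i. k $ i \<in> \<int>" by (auto simp: hlattice_def)
  have "k = (\<chi> i. real_of_int \<lfloor>k $ i\<rfloor>)"
    using k by (auto simp: vec_eq_iff elim: Ints_cases)
  then show "x \<in> range (\<lambda>z. h *\<^sub>R (\<chi> i. real_of_int (z i)))"
    unfolding x by (metis rangeI)
qed (auto simp: hlattice_def)

lemma countable_hlattice: "countable (hlattice h :: (real ^ 'n) set)"
  unfolding hlattice_eq by (intro countable_image) simp

text \<open>A norm bound \<open>R\<close> confines each integer coordinate to absolute value at most
  \<open>R / h\<close>, hence to a finite box. Decay at infinity thereby becomes smallness off a
  finite set.\<close>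

lemma finite_hlattice_bounded:
  assumes h: "0 < h"
  shows "finite {k \<in> hlattice h :: (real ^ 'n) set. norm k \<le> R}"
proof (rule finite_subset)
  let ?Z = "UNIV \<rightarrow>\<^sub>E {- \<lceil>R / h\<rceil>..\<lceil>R / h\<rceil>} :: ('n \<Rightarrow> int) set"
  show "finite ((\<lambda>z. h *\<^sub>R (\<chi> i. real_of_int (z i)) :: real ^ 'n) ` ?Z)"
    by (intro finite_imageI finite_PiE) auto
  show "{k \<in> hlattice h. norm k \<le> R} \<subseteq> (\<lambda>z. h *\<^sub>R (\<chi> i. real_of_int (z i))) ` ?Z"
  proof clarsimp
    fix k :: "real ^ 'n" assume k: "k \<in> hlattice h" and R: "norm k \<le> R"
    obtain z :: "'n \<Rightarrow> int" where z: "k = h *\<^sub>R (\<chi> i. real_of_int (z i))"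
      using k unfolding hlattice_eq by blast
    have "- \<lceil>R / h\<rceil> \<le> z i \<and> z i \<le> \<lceil>R / h\<rceil>" for i
    proof -
      have "\<bar>k $ i\<bar> \<le> R" using component_le_norm_cart[of k i] R by linarith
      then have "\<bar>real_of_int (z i)\<bar> \<le> R / h"
        using h by (simp add: z abs_mult field_simps)
      then show ?thesis by linarith
    qed
    then show "k \<in> (\<lambda>z. h *\<^sub>R (\<chi> i. real_of_int (z i))) ` ?Z"
      using z by (intro image_eqI[of _ _ z]) auto
  qed
qed

lemma hlattice_add: "k \<in> hlattice h \<Longrightarrow> m \<in> hlattice h \<Longrightarrow> k + m \<in> hlattice h"
  unfolding hlattice_def by (fastforce intro: exI[of _ "_ + _"] simp: scaleR_add_right)

lemma hlattice_diff: "k \<in> hlattice h \<Longrightarrow> m \<in> hlattice h \<Longrightarrow> k - m \<in> hlattice h"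
  unfolding hlattice_def by (fastforce intro: exI[of _ "_ - _"] simp: scaleR_diff_right)

text \<open>Bolzano-Weierstrass: the norm bound controls every coordinate, a diagonal argument over
  the countable lattice yields a pointwise convergent subsequence, and the uniform tails upgrade
  this to norm convergence.\<close>

lemma lp_relatively_compact:
  fixes S :: "(real ^ 'n \<Rightarrow> complex) set"
  assumes p: "1 \<le> p" and S: "S \<subseteq> lp h p" and bnd: "\<And>f. f \<in> S \<Longrightarrow> lp_norm h p f \<le> B"
    and tails: "\<And>e. 0 < e \<Longrightarrow> \<exists>K. finite K \<and> K \<subseteq> hlattice h \<and>
      (\<forall>f\<in>S. \<forall>F. finite F \<longrightarrow> F \<subseteq> hlattice h - K \<longrightarrow> (\<Sum>k\<in>F. norm (f k) powr p) \<le> e)"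
  shows "compactin (lp_topology h p) (lp_topology h p closure_of S)"
proof -
  interpret Metric_space "lp h p" "\<lambda>f g :: real ^ 'n \<Rightarrow> complex. lp_norm h p (\<lambda>k. f k - g k)"
    using p by (rule Metric_space_lp)
  \<comment> \<open>The limit is sought in \<open>lp h p\<close> rather than in \<open>S\<close>,
    which is the form of the Bolzano-Weierstrass property that characterises compactness of the
    closure.\<close>
  have "\<exists>l r. l \<in> lp h p \<and> strict_mono r \<and> limitin mtopology (\<sigma> \<circ> r) l sequentially"
    if \<sigma>: "range \<sigma> \<subseteq> S" for \<sigma> :: "nat \<Rightarrow> real ^ 'n \<Rightarrow> complex"
  proof -
    have \<sigma>S: "\<sigma> n \<in> S" and \<sigma>lp: "\<sigma> n \<in> lp h p" for n using \<sigma> S by auto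
    have "norm (\<sigma> n k) \<le> B" for n k
      using lp_norm_pointwise[OF \<sigma>lp, of n k] bnd[OF \<sigma>S, of n] p by linarith
    then obtain r where r: "strict_mono r"
        and conv: "\<And>k. k \<in> hlattice h \<Longrightarrow> \<exists>l. (\<lambda>n. \<sigma> (r n) k) \<longlonglongrightarrow> l"
      using function_convergent_subsequence[OF countable_hlattice[of h], of \<sigma> B] by blast
    have "\<exists>l. (\<lambda>n. \<sigma> (r n) k) \<longlonglongrightarrow> l" for k
      using conv[of k] lp_outside[OF \<sigma>lp] by (cases "k \<in> hlattice h") auto
    then obtain l where l: "\<And>k. (\<lambda>n. \<sigma> (r n) k) \<longlonglongrightarrow> l k" by metis
    have t: "\<exists>K. finite K \<and> K \<subseteq> hlattice h \<and>
      (\<forall>n F. finite F \<longrightarrow> F \<subseteq> hlattice h - K \<longrightarrow> (\<Sum>k\<in>F. norm (\<sigma> (r n) k) powr p) \<le> e)"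
      if "0 < e" for e
      using tails[OF that] \<sigma>S by meson
    note c = lp_converges_if_tails[of p "\<lambda>n. \<sigma> (r n)" h B l, OF p \<sigma>lp bnd[OF \<sigma>S] l t]
    have "limitin mtopology (\<sigma> \<circ> r) l sequentially"
      using c \<sigma>lp by (simp add: limitin_metric_dist_null)
    with c(1) r show ?thesis by blast
  qed
  then have "\<forall>T. T \<subseteq> S \<and> infinite T \<longrightarrow> lp h p \<inter> mtopology derived_set_of T \<noteq> {}"
    using Bolzano_Weierstrass_property[OF S S] by blast
  then show ?thesis
    unfolding lp_topology_def compact_closure_of_eq_Bolzano_Weierstrass by blast
qed

subsection \<open>Kernel operators dominated by a convolution\<close>

text \<open>The matrix is indexed by the offset \<open>m = l - k\<close> from output point to input
  point. A bound on \<open>a k m\<close> by a function of \<open>m\<close> then dominates the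
  operator by a convolution with the reflection of that function.\<close>

definition kernel_op ::
    "real \<Rightarrow> (real ^ 'n \<Rightarrow> real ^ 'n \<Rightarrow> complex) \<Rightarrow> (real ^ 'n \<Rightarrow> complex) \<Rightarrow> real ^ 'n \<Rightarrow> complex" where
  "kernel_op h a f k = (if k \<in> hlattice h then \<Sum>\<^sub>\<infinity>m\<in>hlattice h. a k m * f (k + m) else 0)"

lemma has_sum_sum:
  fixes f :: "'i \<Rightarrow> 'a \<Rightarrow> 'b :: topological_comm_monoid_add"
  assumes "\<And>i. i \<in> I \<Longrightarrow> (f i has_sum s i) A"
  shows "((\<lambda>x. \<Sum>i\<in>I. f i x) has_sum (\<Sum>i\<in>I. s i)) A"
  using assms by (induction I rule: infinite_finite_induct) (auto intro: has_sum_add)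

text \<open>Jensen with weights \<open>w m\<close> moves the power inside the sum over
  \<open>m\<close>. After exchanging it with the finite sum over \<open>F\<close>, each inner sum
  runs over the translate of \<open>F\<close> by \<open>m\<close>, so it is at most
  \<open>lp_norm h p f powr p\<close>.\<close>

lemma
  fixes f :: "real ^ 'n \<Rightarrow> complex"
  assumes p: "1 \<le> p" and f: "f \<in> lp h p"
    and w0: "\<And>m. m \<in> hlattice h \<Longrightarrow> 0 \<le> w m" and w: "w summable_on hlattice h"
  shows summable_on_convolution: "(\<lambda>m. w m * norm (f (k + m))) summable_on hlattice h"
    and young_inequality: "finite F \<Longrightarrow> F \<subseteq> hlattice h \<Longrightarrow>
      (\<Sum>k\<in>F. (\<Sum>\<^sub>\<infinity>m\<in>hlattice h. w m * norm (f (k + m))) powr p)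
        \<le> ((\<Sum>\<^sub>\<infinity>m\<in>hlattice h. w m) * lp_norm h p f) powr p"
proof -
  define N W where "N = lp_norm h p f" and "W = (\<Sum>\<^sub>\<infinity>m\<in>hlattice h. w m)"
  have p0: "0 < p" using p by simp
  have N: "0 \<le> N" and W: "0 \<le> W"
    unfolding N_def W_def using w0 by (auto intro!: infsum_nonneg simp: lp_norm_nonneg)
  have fN: "norm (f k) \<le> N" for k
    unfolding N_def using f p0 by (rule lp_norm_pointwise)
  \<comment> \<open>Since \<open>f\<close> is bounded by \<open>N\<close>, constant multiples of
    \<open>w\<close> are summable majorants, both here and for the powers below.\<close>
  show s1: "(\<lambda>m. w m * norm (f (k + m))) summable_on hlattice h" for k :: "real ^ 'n"
    using summable_on_cmult_left[OF w, of N]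
    by (rule summable_on_comparison_test) (auto intro!: mult_left_mono fN simp: w0)
  have s2: "(\<lambda>m. w m * norm (f (k + m)) powr p) summable_on hlattice h" for k :: "real ^ 'n"
    using summable_on_cmult_left[OF w, of "N powr p"]
    by (rule summable_on_comparison_test) (use p0 in \<open>auto intro!: mult_left_mono powr_mono2 fN simp: w0\<close>)
  assume F: "finite F" "F \<subseteq> hlattice h"
  have "(\<Sum>k\<in>F. (\<Sum>\<^sub>\<infinity>m\<in>hlattice h. w m * norm (f (k + m))) powr p)
      \<le> (\<Sum>k\<in>F. W powr (p - 1) * (\<Sum>\<^sub>\<infinity>m\<in>hlattice h. w m * norm (f (k + m)) powr p))"
    unfolding W_def using p w0 w s1 s2 by (intro sum_mono jensen_powr_infsum) auto
  also have "\<dots> = W powr (p - 1) * (\<Sum>k\<in>F. \<Sum>\<^sub>\<infinity>m\<in>hlattice h. w m * norm (f (k + m)) powr p)"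
    by (simp add: sum_distrib_left)
  also have "\<dots> \<le> W powr (p - 1) * (W * N powr p)"
  proof (rule mult_left_mono)
    have hs: "((\<lambda>m. \<Sum>k\<in>F. w m * norm (f (k + m)) powr p) has_sum
        (\<Sum>k\<in>F. \<Sum>\<^sub>\<infinity>m\<in>hlattice h. w m * norm (f (k + m)) powr p)) (hlattice h)"
      using s2 by (intro has_sum_sum has_sum_infsum)
    show "(\<Sum>k\<in>F. \<Sum>\<^sub>\<infinity>m\<in>hlattice h. w m * norm (f (k + m)) powr p) \<le> W * N powr p"
    proof (rule has_sum_mono[OF hs])
      show "((\<lambda>m. w m * N powr p) has_sum (W * N powr p)) (hlattice h)"
        unfolding W_def using w by (intro has_sum_cmult_left has_sum_infsum)
      fix m :: "real ^ 'n" assume m: "m \<in> hlattice h"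
      have "(\<Sum>k\<in>F. norm (f (k + m)) powr p) = (\<Sum>k\<in>(\<lambda>k. k + m) ` F. norm (f k) powr p)"
        by (subst sum.reindex) auto
      also have "\<dots> \<le> N powr p"
        unfolding N_def using F m by (intro lp_sum_le[OF f p0]) (auto intro: hlattice_add)
      finally show "(\<Sum>k\<in>F. w m * norm (f (k + m)) powr p) \<le> w m * N powr p"
        unfolding sum_distrib_left[symmetric] using w0[OF m] by (rule mult_left_mono)
    qed
  qed simp
  also have "\<dots> = (W * N) powr p"
    using W N by (cases "W = 0") (auto simp: powr_mult powr_diff)
  finally show "(\<Sum>k\<in>F. (\<Sum>\<^sub>\<infinity>m\<in>hlattice h. w m * norm (f (k + m))) powr p)
      \<le> ((\<Sum>\<^sub>\<infinity>m\<in>hlattice h. w m) * lp_norm h p f) powr p"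
    by (simp add: N_def W_def)
qed

lemma kernel_op_abs_summable:
  fixes f :: "real ^ 'n \<Rightarrow> complex"
  assumes p: "1 \<le> p" and f: "f \<in> lp h p"
    and w0: "\<And>m. m \<in> hlattice h \<Longrightarrow> 0 \<le> w m" and w: "w summable_on hlattice h"
    and a: "\<And>m. m \<in> hlattice h \<Longrightarrow> norm (a k m) \<le> c * w m"
  shows "(\<lambda>m. norm (a k m * f (k + m))) summable_on hlattice h"
proof (rule Infinite_Sum.abs_summable_on_comparison_test')
  show "(\<lambda>m. c * (w m * norm (f (k + m)))) summable_on hlattice h"
    using p f w0 w by (intro summable_on_cmult_right summable_on_convolution)
  show "norm (a k m * f (k + m)) \<le> c * (w m * norm (f (k + m)))" if "m \<in> hlattice h" for m
    using mult_right_mono[OF a[OF that], of "norm (f (k + m))"] by (simp add: norm_mult mult.assoc)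
qed

text \<open>Domination by \<open>c\<close> times the convolution, then Young's inequality. The
  kernel bound is asked only for \<open>k \<in> F\<close>: this gives the global norm bound with one
  fixed \<open>c\<close>, and small tails when \<open>F\<close> avoids a large ball and
  \<open>c\<close> is small.\<close>

lemma kernel_op_sum_le:
  fixes f :: "real ^ 'n \<Rightarrow> complex"
  assumes p: "1 \<le> p" and f: "f \<in> lp h p"
    and w0: "\<And>m. m \<in> hlattice h \<Longrightarrow> 0 \<le> w m" and w: "w summable_on hlattice h"
    and F: "finite F" "F \<subseteq> hlattice h" and c: "0 \<le> c"
    and a: "\<And>k m. k \<in> F \<Longrightarrow> m \<in> hlattice h \<Longrightarrow> norm (a k m) \<le> c * w m"
  shows "(\<Sum>k\<in>F. norm (kernel_op h a f k) powr p)
      \<le> (c * ((\<Sum>\<^sub>\<infinity>m\<in>hlattice h. w m) * lp_norm h p f)) powr p"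
proof -
  have "norm (kernel_op h a f k) \<le> c * (\<Sum>\<^sub>\<infinity>m\<in>hlattice h. w m * norm (f (k + m)))"
    if k: "k \<in> F" for k
  proof -
    have s: "(\<lambda>m. norm (a k m * f (k + m))) summable_on hlattice h"
      using p f w0 w a[OF k] by (rule kernel_op_abs_summable)
    have "norm (kernel_op h a f k) \<le> (\<Sum>\<^sub>\<infinity>m\<in>hlattice h. norm (a k m * f (k + m)))"
      unfolding kernel_op_def using k F norm_infsum_bound[OF s] by auto
    also have "\<dots> \<le> (\<Sum>\<^sub>\<infinity>m\<in>hlattice h. c * (w m * norm (f (k + m))))"
    proof (rule infsum_mono)
      show "norm (a k m * f (k + m)) \<le> c * (w m * norm (f (k + m)))" if "m \<in> hlattice h" for m
        using mult_right_mono[OF a[OF k that], of "norm (f (k + m))"] by (simp add: norm_mult mult.assoc)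
    qed (use s p f w0 w in \<open>auto intro!: summable_on_cmult_right summable_on_convolution\<close>)
    finally show ?thesis by (simp add: infsum_cmult_right')
  qed
  then have "(\<Sum>k\<in>F. norm (kernel_op h a f k) powr p)
      \<le> (\<Sum>k\<in>F. (c * (\<Sum>\<^sub>\<infinity>m\<in>hlattice h. w m * norm (f (k + m)))) powr p)"
    using p by (intro sum_mono powr_mono2) auto
  also have "\<dots> = c powr p * (\<Sum>k\<in>F. (\<Sum>\<^sub>\<infinity>m\<in>hlattice h. w m * norm (f (k + m))) powr p)"
    using c w0 by (simp add: sum_distrib_left powr_mult infsum_nonneg)
  also have "\<dots> \<le> c powr p * ((\<Sum>\<^sub>\<infinity>m\<in>hlattice h. w m) * lp_norm h p f) powr p"
    using young_inequality[OF p f w0 w F] by (intro mult_left_mono) auto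
  also have "\<dots> = (c * ((\<Sum>\<^sub>\<infinity>m\<in>hlattice h. w m) * lp_norm h p f)) powr p"
    using c w0 by (simp add: powr_mult infsum_nonneg lp_norm_nonneg)
  finally show ?thesis .
qed

lemma
  fixes f :: "real ^ 'n \<Rightarrow> complex"
  assumes p: "1 \<le> p" and f: "f \<in> lp h p"
    and w0: "\<And>m. m \<in> hlattice h \<Longrightarrow> 0 \<le> w m" and w: "w summable_on hlattice h" and c: "0 \<le> c"
    and a: "\<And>k m. k \<in> hlattice h \<Longrightarrow> m \<in> hlattice h \<Longrightarrow> norm (a k m) \<le> c * w m"
  shows kernel_op_lp: "kernel_op h a f \<in> lp h p"
    and lp_norm_kernel_op: "lp_norm h p (kernel_op h a f)
      \<le> c * ((\<Sum>\<^sub>\<infinity>m\<in>hlattice h. w m) * lp_norm h p f)"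
proof -
  have "0 \<le> c * ((\<Sum>\<^sub>\<infinity>m\<in>hlattice h. w m) * lp_norm h p f)"
    using c w0 by (simp add: infsum_nonneg lp_norm_nonneg)
  moreover have "(\<Sum>k\<in>F. norm (kernel_op h a f k) powr p)
      \<le> (c * ((\<Sum>\<^sub>\<infinity>m\<in>hlattice h. w m) * lp_norm h p f)) powr p"
    if "finite F" "F \<subseteq> hlattice h" for F
    using kernel_op_sum_le[OF p f w0 w that c] a that by blast
  ultimately show "kernel_op h a f \<in> lp h p"
    "lp_norm h p (kernel_op h a f) \<le> c * ((\<Sum>\<^sub>\<infinity>m\<in>hlattice h. w m) * lp_norm h p f)"
    using p lp_norm_le[of h "kernel_op h a f" p] by (auto simp: kernel_op_def)
qed

lemma lp_bounded_linear_kernel_op: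
  fixes a :: "real ^ 'n \<Rightarrow> real ^ 'n \<Rightarrow> complex"
  assumes p: "1 \<le> p"
    and w0: "\<And>m. m \<in> hlattice h \<Longrightarrow> 0 \<le> w m" and w: "w summable_on hlattice h" and c: "0 \<le> c"
    and a: "\<And>k m. k \<in> hlattice h \<Longrightarrow> m \<in> hlattice h \<Longrightarrow> norm (a k m) \<le> c * w m"
  shows "lp_bounded_linear h p (kernel_op h a)"
  unfolding lp_bounded_linear_def
proof (intro conjI ballI allI)
  fix f :: "real ^ 'n \<Rightarrow> complex" assume f: "f \<in> lp h p"
  show "kernel_op h a f \<in> lp h p"
    using p f w0 w c a by (rule kernel_op_lp)
  show "kernel_op h a (\<lambda>k. z * f k) = (\<lambda>k. z * kernel_op h a f k)" for z
    by (auto simp: kernel_op_def fun_eq_iff mult.left_commute simp flip: infsum_cmult_right')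
  fix g :: "real ^ 'n \<Rightarrow> complex" assume g: "g \<in> lp h p"
  have s: "(\<lambda>m. a k m * u (k + m)) summable_on hlattice h" if "k \<in> hlattice h" "u \<in> lp h p" for k and u :: "real ^ 'n \<Rightarrow> complex"
  proof (rule Infinite_Sum.abs_summable_summable)
    show "(\<lambda>m. norm (a k m * u (k + m))) summable_on hlattice h"
      using p that(2) w0 w a[OF that(1)] by (rule kernel_op_abs_summable)
  qed
  show "kernel_op h a (\<lambda>k. f k + g k) = (\<lambda>k. kernel_op h a f k + kernel_op h a g k)"
    using infsum_add[OF s[OF _ f] s[OF _ g]] by (auto simp: kernel_op_def fun_eq_iff distrib_left)
next
  show "\<exists>B. \<forall>f\<in>lp h p. lp_norm h p (kernel_op h a f) \<le> B * lp_norm h p f"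
    using lp_norm_kernel_op[OF p _ w0 w c a]
    by (intro exI[of _ "c * (\<Sum>\<^sub>\<infinity>m\<in>hlattice h. w m)"]) (auto simp: mult.assoc)
qed

section \<open>Density of finitely supported functions and uniqueness of the bounded
  extension\<close>

text \<open>The exponent is free, so one and the same truncation lies in \<open>lp h 1\<close> and
  in \<open>lp h p\<close>; this links the two spaces in the density argument.\<close>

lemma lp_finite_support:
  assumes "finite K" "K \<subseteq> hlattice h" "0 < p"
  shows "(\<lambda>k. if k \<in> K then f k else 0) \<in> lp h p"
proof -
  have "(\<lambda>k. norm (if k \<in> K then f k else 0) powr p) summable_on hlattice h
      \<longleftrightarrow> (\<lambda>k. norm (f k) powr p) summable_on K"
    using assms by (intro summable_on_cong_neutral) auto
  then show ?thesis using assms by (auto simp: lp_def)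
qed

lemma lp_dense_finite_support:
  assumes p: "0 < p" and f: "f \<in> lp h p" and e: "0 < e"
  obtains K where "finite K" "K \<subseteq> hlattice h" "lp_norm h p (\<lambda>k. f k - (if k \<in> K then f k else 0)) \<le> e"
proof -
  obtain K where K: "finite K" "K \<subseteq> hlattice h"
    and tail: "\<And>F. finite F \<Longrightarrow> F \<subseteq> hlattice h - K \<Longrightarrow> (\<Sum>k\<in>F. norm (f k) powr p) \<le> e powr p"
    using lp_tail[OF f, of "e powr p"] e by auto
  have "lp_norm h p (\<lambda>k. f k - (if k \<in> K then f k else 0)) \<le> e"
  proof (rule lp_norm_le(2))
    fix F :: "(real ^ 'a) set" assume F: "finite F" "F \<subseteq> hlattice h"
    have "(\<Sum>k\<in>F. norm (f k - (if k \<in> K then f k else 0)) powr p) = (\<Sum>k\<in>F - K. norm (f k) powr p)"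
      using F p by (intro sum.mono_neutral_cong_right) auto
    also have "\<dots> \<le> e powr p" using F by (intro tail) auto
    finally show "(\<Sum>k\<in>F. norm (f k - (if k \<in> K then f k else 0)) powr p) \<le> e powr p" .
  qed (use p e f K in \<open>auto simp: lp_outside\<close>)
  with K show thesis by (rule that)
qed

lemma lp_bounded_linear_diff:
  assumes p: "1 \<le> p" and T: "lp_bounded_linear h p T" and f: "f \<in> lp h p" and g: "g \<in> lp h p"
  shows "T (\<lambda>k. f k - g k) = (\<lambda>k. T f k - T g k)"
proof -
  have "T (\<lambda>k. f k + (-1) * g k) = (\<lambda>k. T f k + T (\<lambda>k. (-1) * g k) k)"
    using T[unfolded lp_bounded_linear_def, THEN conjunct2, THEN conjunct1, rule_format,
        OF f lp_cmult[OF g, of "-1"]] .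
  also have "T (\<lambda>k. (-1) * g k) = (\<lambda>k. (-1) * T g k)"
    using T g unfolding lp_bounded_linear_def by blast
  finally show ?thesis by simp
qed

lemma lp_bounded_linear_bound:
  assumes "lp_bounded_linear h p T"
  obtains B where "0 < B" "\<And>f. f \<in> lp h p \<Longrightarrow> lp_norm h p (T f) \<le> B * lp_norm h p f"
proof -
  obtain B where B: "\<And>f. f \<in> lp h p \<Longrightarrow> lp_norm h p (T f) \<le> B * lp_norm h p f"
    using assms unfolding lp_bounded_linear_def by blast
  have "lp_norm h p (T f) \<le> max B 1 * lp_norm h p f" if "f \<in> lp h p" for f
    using B[OF that] mult_right_mono[of B "max B 1" "lp_norm h p f"] lp_norm_nonneg[of h p f] by linarith
  then show thesis by (intro that[of "max B 1"]) auto
qed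

text \<open>Both operators agree on a finite truncation \<open>g\<close> of \<open>f\<close>. The
  remainder \<open>r\<close> has norm at most \<open>e / (B + D)\<close>, so \<open>T r\<close> and
  \<open>S r\<close> differ by at most \<open>e\<close>; let \<open>e\<close> tend to zero.\<close>

lemma lp_bounded_linear_eqI:
  assumes p: "1 \<le> p" and T: "lp_bounded_linear h p T" and S: "lp_bounded_linear h p S"
    and eq: "\<And>f. f \<in> lp h 1 \<Longrightarrow> T f = S f" and f: "f \<in> lp h p"
  shows "T f = S f"
proof -
  have p0: "0 < p" using p by simp
  obtain B where B: "0 < B" "\<And>f. f \<in> lp h p \<Longrightarrow> lp_norm h p (T f) \<le> B * lp_norm h p f"
    using lp_bounded_linear_bound[OF T] by blast
  obtain D where D: "0 < D" "\<And>f. f \<in> lp h p \<Longrightarrow> lp_norm h p (S f) \<le> D * lp_norm h p f"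
    using lp_bounded_linear_bound[OF S] by blast
  have Tf: "T f \<in> lp h p" and Sf: "S f \<in> lp h p"
    using T S f unfolding lp_bounded_linear_def by auto
  have "lp_norm h p (\<lambda>k. T f k - S f k) \<le> 0 + e" if e: "0 < e" for e
  proof -
    obtain K where K: "finite K" "K \<subseteq> hlattice h"
      and fK: "lp_norm h p (\<lambda>k. f k - (if k \<in> K then f k else 0)) \<le> e / (B + D)"
      using lp_dense_finite_support[OF p0 f, of "e / (B + D)"] e B D by auto
    define g where "g = (\<lambda>k. if k \<in> K then f k else 0)"
    define r where "r = (\<lambda>k. f k - g k)"
    have g: "g \<in> lp h p" "T g = S g"
      unfolding g_def using K p0 by (auto intro!: lp_finite_support eq)
    have r: "r \<in> lp h p" unfolding r_def by (rule lp_diff[OF p f g(1)])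
    have "T f k - S f k = T r k - S r k" for k
      unfolding r_def using lp_bounded_linear_diff[OF p T f g(1)] lp_bounded_linear_diff[OF p S f g(1)] g(2)
      by simp
    then have "lp_norm h p (\<lambda>k. T f k - S f k) = lp_norm h p (\<lambda>k. T r k + (-1) * S r k)" by simp
    also have "\<dots> \<le> lp_norm h p (T r) + lp_norm h p (\<lambda>k. (-1) * S r k)"
      using T S r unfolding lp_bounded_linear_def by (intro lp_norm_triangle[OF p] lp_cmult) auto
    also have "lp_norm h p (\<lambda>k. (-1) * S r k) = lp_norm h p (S r)"
      by (simp add: lp_norm_def)
    also have "lp_norm h p (T r) + lp_norm h p (S r) \<le> (B + D) * lp_norm h p r"
      using B(2)[OF r] D(2)[OF r] by (simp add: algebra_simps)
    also have "\<dots> \<le> (B + D) * (e / (B + D))"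
      using fK B D by (intro mult_left_mono) (auto simp: r_def g_def)
    also have "\<dots> = e" using B D by simp
    finally show ?thesis by simp
  qed
  then have "lp_norm h p (\<lambda>k. T f k - S f k) \<le> 0" by (rule field_le_epsilon)
  then have "lp_norm h p (\<lambda>k. T f k - S f k) = 0"
    using lp_norm_nonneg[of h p "\<lambda>k. T f k - S f k"] by linarith
  then show ?thesis
    using lp_norm_eq_0_iff[OF lp_diff[OF p Tf Sf] p0] by (simp add: fun_eq_iff)
qed

subsection \<open>The quantization as a kernel operator\<close>

text \<open>An enumeration of \<open>A\<close> reduces this to termwise integration of a series, and
  absolute summability identifies the unordered sums with the series. Finite \<open>A\<close> is
  separate because no bijection with the naturals exists.\<close>

lemma integral_infsum:
  fixes f :: "'a \<Rightarrow> 'b \<Rightarrow> 'c :: {banach, second_countable_topology}"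
  assumes A: "countable A"
    and f: "\<And>a. a \<in> A \<Longrightarrow> integrable M (f a)"
    and s: "\<And>x. x \<in> space M \<Longrightarrow> (\<lambda>a. norm (f a x)) summable_on A"
    and s': "(\<lambda>a. \<integral>x. norm (f a x) \<partial>M) summable_on A"
  shows "(\<integral>x. (\<Sum>\<^sub>\<infinity>a\<in>A. f a x) \<partial>M) = (\<Sum>\<^sub>\<infinity>a\<in>A. \<integral>x. f a x \<partial>M)"
proof (cases "finite A")
  case True
  then show ?thesis using f by simp
next
  case False
  define e where "e = from_nat_into A"
  have e: "bij_betw e UNIV A"
    unfolding e_def using A False by (rule bij_betw_from_nat_into)
  have eA: "e i \<in> A" for i using bij_betwE[OF e] by simp
  have sm: "summable (\<lambda>i. g (e i))" if "g summable_on A" for g :: "'a \<Rightarrow> real"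
    using that summable_on_reindex_bij_betw[OF e, of g]
    by (auto simp: summable_on_def summable_def dest!: has_sum_imp_sums)
  have nn: "(\<Sum>\<^sub>\<infinity>a\<in>A. g a) = (\<Sum>i. g (e i))" if "(\<lambda>a. norm (g a)) summable_on A" for g :: "'a \<Rightarrow> 'c"
  proof -
    have "g summable_on A" using that by (rule Infinite_Sum.abs_summable_summable)
    then have "((\<lambda>i. g (e i)) has_sum (\<Sum>\<^sub>\<infinity>a\<in>A. g a)) UNIV"
      using has_sum_reindex_bij_betw[OF e, of g] by simp
    then show ?thesis by (auto dest!: has_sum_imp_sums simp: sums_iff)
  qed
  have "(\<integral>x. (\<Sum>\<^sub>\<infinity>a\<in>A. f a x) \<partial>M) = (\<integral>x. (\<Sum>i. f (e i) x) \<partial>M)"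
    using s by (intro Bochner_Integration.integral_cong nn) auto
  also have "\<dots> = (\<Sum>i. \<integral>x. f (e i) x \<partial>M)"
    using f eA sm[OF s] sm[OF s'] by (intro integral_suminf) auto
  also have "\<dots> = (\<Sum>\<^sub>\<infinity>a\<in>A. \<integral>x. f a x \<partial>M)"
  proof (rule nn[symmetric])
    show "(\<lambda>a. norm (\<integral>x. f a x \<partial>M)) summable_on A"
      using s' by (rule summable_on_comparison_test) auto
  qed
  finally show ?thesis .
qed

lemma norm_exp_phase: "norm (exp (z * of_real pi * (\<i> / of_real h) * of_real t)) = 1"
  if "z = 2 \<or> z = - 2" for z :: complex
  using that by (auto simp: norm_exp_eq_Re)

text \<open>The phase at \<open>k\<close> cancels part of the phase at frequency
  \<open>k + m\<close> and leaves the one at \<open>m\<close>. All phases have modulus one and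
  \<open>f\<close> is absolutely summable, so integration is termwise and each integral is a Fourier
  coefficient of \<open>\<sigma> k\<close>.\<close>

lemma Op_hlattice_eq_kernel_op:
  fixes \<sigma> :: "real ^ 'n \<Rightarrow> real ^ 'n \<Rightarrow> complex"
  assumes \<sigma>: "\<And>k. k \<in> hlattice h \<Longrightarrow> integrable torus_measure (\<sigma> k)" and f: "f \<in> lp h 1"
  shows "Op_hlattice h \<sigma> f = kernel_op h (torus_fourier h \<sigma>) f"
proof
  fix k :: "real ^ 'n"
  show "Op_hlattice h \<sigma> f k = kernel_op h (torus_fourier h \<sigma>) f k"
  proof (cases "k \<in> hlattice h")
    case k: True
    define E :: "real ^ 'n \<Rightarrow> real ^ 'n \<Rightarrow> complex"
      where "E = (\<lambda>m \<theta>. exp (- 2 * of_real pi * (\<i> / of_real h) * of_real (m \<bullet> \<theta>)))"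
    have E: "norm (E m \<theta>) = 1" for m \<theta>
      unfolding E_def by (rule norm_exp_phase) simp
    have intE: "integrable torus_measure (\<lambda>\<theta>. E m \<theta> * \<sigma> k \<theta>)" for m
    proof (rule Bochner_Integration.integrable_bound[OF \<sigma>[OF k]])
      have "E m \<in> borel_measurable torus_measure"
        unfolding torus_measure_def E_def
        by (intro continuous_imp_measurable_on_sets_lebesgue continuous_intros) auto
      then show "(\<lambda>\<theta>. E m \<theta> * \<sigma> k \<theta>) \<in> borel_measurable torus_measure"
        using \<sigma>[OF k] by (intro borel_measurable_times) auto
    qed (simp add: norm_mult E)
    have fs: "(\<lambda>m. norm (f (k + m))) summable_on hlattice h"
    proof -
      have "(\<lambda>m. norm (f (k + m))) summable_on hlattice h \<longleftrightarrow> (\<lambda>l. norm (f l)) summable_on hlattice h"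
        by (rule summable_on_reindex_bij_witness[of _ "\<lambda>l. l - k" "\<lambda>m. k + m"])
          (use k in \<open>auto intro: hlattice_add hlattice_diff\<close>)
      then show ?thesis using f by (simp add: lp_def)
    qed
    have "exp (2 * of_real pi * (\<i> / of_real h) * of_real (k \<bullet> \<theta>)) * \<sigma> k \<theta> * semiclassical_fourier h f \<theta>
        = (\<Sum>\<^sub>\<infinity>m\<in>hlattice h. E m \<theta> * \<sigma> k \<theta> * f (k + m))" for \<theta>
    proof -
      have "semiclassical_fourier h f \<theta> = (\<Sum>\<^sub>\<infinity>l\<in>hlattice h. E l \<theta> * f l)"
        by (simp add: semiclassical_fourier_def E_def)
      also have "\<dots> = (\<Sum>\<^sub>\<infinity>m\<in>hlattice h. E (k + m) \<theta> * f (k + m))"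
        by (rule infsum_reindex_bij_witness[of _ "\<lambda>m. k + m" "\<lambda>l. l - k"])
          (use k in \<open>auto intro: hlattice_add hlattice_diff\<close>)
      also have "exp (2 * of_real pi * (\<i> / of_real h) * of_real (k \<bullet> \<theta>)) * \<sigma> k \<theta> * \<dots>
          = (\<Sum>\<^sub>\<infinity>m\<in>hlattice h.
              exp (2 * of_real pi * (\<i> / of_real h) * of_real (k \<bullet> \<theta>)) * \<sigma> k \<theta> * (E (k + m) \<theta> * f (k + m)))"
        by (rule infsum_cmult_right'[symmetric])
      also have "\<dots> = (\<Sum>\<^sub>\<infinity>m\<in>hlattice h. E m \<theta> * \<sigma> k \<theta> * f (k + m))"
      proof (rule infsum_cong)
        fix m :: "real ^ 'n"
        have "exp (2 * of_real pi * (\<i> / of_real h) * of_real (k \<bullet> \<theta>)) * E (k + m) \<theta> = E m \<theta>"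
          unfolding E_def exp_add[symmetric]
          by (simp add: inner_add_left algebra_simps add_divide_distrib)
        then show "exp (2 * of_real pi * (\<i> / of_real h) * of_real (k \<bullet> \<theta>)) * \<sigma> k \<theta> * (E (k + m) \<theta> * f (k + m))
            = E m \<theta> * \<sigma> k \<theta> * f (k + m)"
          by (metis mult.assoc mult.commute)
      qed
      finally show ?thesis .
    qed
    then have "Op_hlattice h \<sigma> f k
        = (\<integral>\<theta>. (\<Sum>\<^sub>\<infinity>m\<in>hlattice h. E m \<theta> * \<sigma> k \<theta> * f (k + m)) \<partial>torus_measure)"
      using k by (simp add: Op_hlattice_def)
    also have "\<dots> = (\<Sum>\<^sub>\<infinity>m\<in>hlattice h. \<integral>\<theta>. E m \<theta> * \<sigma> k \<theta> * f (k + m) \<partial>torus_measure)"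
    proof (rule integral_infsum[OF countable_hlattice])
      show "integrable torus_measure (\<lambda>\<theta>. E m \<theta> * \<sigma> k \<theta> * f (k + m))" for m
        using intE by simp
      show "(\<lambda>m. norm (E m \<theta> * \<sigma> k \<theta> * f (k + m))) summable_on hlattice h" for \<theta>
        using fs by (simp add: norm_mult E summable_on_cmult_right)
      show "(\<lambda>m. \<integral>\<theta>. norm (E m \<theta> * \<sigma> k \<theta> * f (k + m)) \<partial>torus_measure) summable_on hlattice h"
        using fs by (simp add: norm_mult E summable_on_cmult_right)
    qed
    also have "\<dots> = kernel_op h (torus_fourier h \<sigma>) f k"
      using k by (simp add: kernel_op_def torus_fourier_def E_def)
    finally show ?thesis .
  qed (simp add: Op_hlattice_def kernel_op_def)
qed

subsection \<open>Compactness\<close>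

lemma lp_compact_operator_cong:
  assumes T: "lp_bounded_linear h p T" and eq: "\<And>f. f \<in> lp h p \<Longrightarrow> T f = S f"
    and S: "lp_compact_operator h p S"
  shows "lp_compact_operator h p T"
proof -
  have "T ` {f \<in> lp h p. lp_norm h p f \<le> 1} = S ` {f \<in> lp h p. lp_norm h p f \<le> 1}"
    using eq by (intro image_cong) auto
  then show ?thesis using T S by (simp add: lp_compact_operator_def)
qed

text \<open>The two kernel bounds act at different places: the constant \<open>c\<close> gives
  boundedness on the whole lattice, while \<open>\<omega> k\<close> replaces it by an arbitrarily
  small constant far from the origin and so makes the tails uniformly small.\<close>

lemma lp_compact_kernel_op:
  fixes a :: "real ^ 'n \<Rightarrow> real ^ 'n \<Rightarrow> complex"
  assumes h: "0 < h" and p: "1 \<le> p"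
    and w0: "\<And>m. m \<in> hlattice h \<Longrightarrow> 0 \<le> w m" and w: "w summable_on hlattice h" and c: "0 \<le> c"
    and a: "\<And>k m. k \<in> hlattice h \<Longrightarrow> m \<in> hlattice h \<Longrightarrow> norm (a k m) \<le> c * w m"
    and a\<omega>: "\<And>k m. k \<in> hlattice h \<Longrightarrow> m \<in> hlattice h \<Longrightarrow> norm (a k m) \<le> \<omega> k * w m"
    and \<omega>: "(\<omega> \<longlongrightarrow> 0) (inf at_infinity (principal (hlattice h)))"
  shows "lp_compact_operator h p (kernel_op h a)"
  unfolding lp_compact_operator_def
proof
  define W where "W = (\<Sum>\<^sub>\<infinity>m\<in>hlattice h. w m)"
  have W: "0 \<le> W" unfolding W_def using w0 by (rule infsum_nonneg)
  show bl: "lp_bounded_linear h p (kernel_op h a)"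
    using p w0 w c a by (rule lp_bounded_linear_kernel_op)
  show "compactin (lp_topology h p)
    (lp_topology h p closure_of kernel_op h a ` {f \<in> lp h p. lp_norm h p f \<le> 1})"
  proof (rule lp_relatively_compact[OF p])
    show "kernel_op h a ` {f \<in> lp h p. lp_norm h p f \<le> 1} \<subseteq> lp h p"
      using bl by (auto simp: lp_bounded_linear_def)
    show "lp_norm h p g \<le> c * W" if "g \<in> kernel_op h a ` {f \<in> lp h p. lp_norm h p f \<le> 1}" for g
    proof -
      obtain f where f: "f \<in> lp h p" "lp_norm h p f \<le> 1" and g: "g = kernel_op h a f"
        using \<open>g \<in> _\<close> by blast
      have "lp_norm h p g \<le> c * (W * lp_norm h p f)"
        unfolding g W_def using p f(1) w0 w c a by (rule lp_norm_kernel_op)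
      also have "\<dots> \<le> c * (W * 1)"
        using c W f by (intro mult_left_mono) auto
      finally show ?thesis by simp
    qed
    fix e :: real assume e: "0 < e"
    \<comment> \<open>Chosen so that \<open>(d * (W + 1)) powr p = e\<close>; the summand
      \<open>1\<close> keeps the denominator positive even if \<open>W = 0\<close>.\<close>
    define d where "d = e powr (1 / p) / (W + 1)"
    have d: "0 < d" using e W by (simp add: d_def)
    have "\<forall>\<^sub>F k in inf at_infinity (principal (hlattice h)). \<omega> k < d"
      using order_tendstoD(2)[OF \<omega> d] .
    then obtain R where R: "\<And>k. k \<in> hlattice h \<Longrightarrow> R \<le> norm k \<Longrightarrow> \<omega> k < d"
      by (auto simp: eventually_inf_principal eventually_at_infinity)
    \<comment> \<open>Lattice points off \<open>K\<close> have norm above \<open>R\<close>, where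
      \<open>\<omega>\<close> is below \<open>d\<close>; this choice does not depend on
      \<open>f\<close>, so the tails are uniform over the unit ball.\<close>
    define K where "K = {k \<in> hlattice h :: (real ^ 'n) set. norm k \<le> R}"
    have "(\<Sum>k\<in>F. norm (kernel_op h a f k) powr p) \<le> e"
      if f: "f \<in> lp h p" "lp_norm h p f \<le> 1" and F: "finite F" "F \<subseteq> hlattice h - K" for f F
    proof -
      have "(\<Sum>k\<in>F. norm (kernel_op h a f k) powr p) \<le> (d * (W * lp_norm h p f)) powr p"
        unfolding W_def
      proof (rule kernel_op_sum_le[OF p f(1) w0 w F(1)])
        fix k m :: "real ^ 'n" assume k: "k \<in> F" and m: "m \<in> hlattice h"
        have kh: "k \<in> hlattice h" and "\<omega> k < d"
          using k F R[of k] by (auto simp: K_def subset_iff)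
        then have "\<omega> k * w m \<le> d * w m"
          using w0[OF m] by (intro mult_right_mono) auto
        with a\<omega>[OF kh m] show "norm (a k m) \<le> d * w m" by linarith
      qed (use F d in auto)
      also have "\<dots> \<le> (d * (W + 1)) powr p"
      proof (rule powr_mono2)
        have "W * lp_norm h p f \<le> W * 1" using W f by (intro mult_left_mono) auto
        then show "d * (W * lp_norm h p f) \<le> d * (W + 1)"
          using d by (intro mult_left_mono) auto
      qed (use p d W in \<open>auto simp: lp_norm_nonneg\<close>)
      also have "\<dots> = e" using W e p by (simp add: d_def powr_powr)
      finally show ?thesis .
    qed
    then show "\<exists>K. finite K \<and> K \<subseteq> hlattice h \<and>
        (\<forall>f\<in>kernel_op h a ` {f \<in> lp h p. lp_norm h p f \<le> 1}.
          \<forall>F. finite F \<longrightarrow> F \<subseteq> hlattice h - K \<longrightarrow> (\<Sum>k\<in>F. norm (f k) powr p) \<le> e)"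
      using finite_hlattice_bounded[OF h, where 'n = 'n, of R] by (intro exI[of _ K]) (auto simp: K_def)
  qed
qed

theorem theorem6p16:
  fixes h C p :: real
    and \<sigma> :: "real ^ 'n \<Rightarrow> real ^ 'n \<Rightarrow> complex"
    and lam :: "real ^ 'n \<Rightarrow> complex"
    and \<omega> :: "real ^ 'n \<Rightarrow> real"
  assumes h: "0 < h" "h \<le> 1"
    and \<sigma>_torus: "\<forall>k\<in>hlattice h. torus_periodic (\<sigma> k)"
    and \<sigma>_measurable:
      "(\<lambda>(k, \<theta>). \<sigma> k \<theta>) \<in> borel_measurable (count_space (hlattice h) \<Otimes>\<^sub>M torus_measure)"
    and \<sigma>_integrable: "\<forall>k\<in>hlattice h. integrable torus_measure (\<sigma> k)"
    and lam: "lam \<in> lp h 1"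
    and \<omega>_pos: "\<forall>k\<in>hlattice h. 0 < \<omega> k"
    and C_pos: "0 < C"
    and C_bound: "\<forall>k\<in>hlattice h. \<forall>m\<in>hlattice h. norm (torus_fourier h \<sigma> k m) \<le> C * norm (lam m)"
    and \<omega>_bound: "\<forall>m\<in>hlattice h. \<forall>k\<in>hlattice h. norm (torus_fourier h \<sigma> k m) \<le> \<omega> k * norm (lam m)"
    and \<omega>_lim: "(\<omega> \<longlongrightarrow> 0) (inf at_infinity (principal (hlattice h)))"
    and p: "1 \<le> p"
  shows "(\<exists>T. is_Op_extension h \<sigma> p T) \<and>
         (\<forall>T. is_Op_extension h \<sigma> p T \<longrightarrow> lp_compact_operator h p T)"
proof -
  let ?S = "kernel_op h (torus_fourier h \<sigma>)"
  have "(\<lambda>m. norm (lam m)) summable_on hlattice h"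
    using lam by (simp add: lp_def)
  then have S: "lp_compact_operator h p ?S"
    using h p C_pos C_bound \<omega>_bound \<omega>_lim
    by (intro lp_compact_kernel_op[where w = "\<lambda>m. norm (lam m)" and c = C and \<omega> = \<omega>]) auto
  have Op: "Op_hlattice h \<sigma> f = ?S f" if "f \<in> lp h 1" for f
    using \<sigma>_integrable that by (intro Op_hlattice_eq_kernel_op) auto
  show ?thesis
  proof (intro conjI allI impI)
    \<comment> \<open>The kernel operator is itself an extension, so the compactness claim for all
      extensions is not vacuous.\<close>
    show "\<exists>T. is_Op_extension h \<sigma> p T"
      using S Op by (intro exI[of _ ?S]) (simp add: is_Op_extension_def lp_compact_operator_def)
    fix T :: "(real ^ 'n \<Rightarrow> complex) \<Rightarrow> real ^ 'n \<Rightarrow> complex" assume "is_Op_extension h \<sigma> p T"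
    then have T: "lp_bounded_linear h p T" and TS: "\<And>f. f \<in> lp h 1 \<Longrightarrow> T f = ?S f"
      using Op by (auto simp: is_Op_extension_def)
    \<comment> \<open>Agreement on the dense subspace \<open>lp h 1\<close> propagates to
      \<open>lp h p\<close>, so every extension has the same image of the unit ball as the compact
      kernel operator.\<close>
    have "T f = ?S f" if "f \<in> lp h p" for f
      using S by (intro lp_bounded_linear_eqI[OF p T _ TS that]) (auto simp: lp_compact_operator_def)
    then show "lp_compact_operator h p T"
      using T S by (intro lp_compact_operator_cong[of h p T ?S])
  qed
qed

end
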